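(* The class of strong-P-rankable sets is closed under join: if $A, B\subseteq\Sigma^*$ are strong-P-rankable, then $A\oplus B$ is strong-P-rankable.
   Context: $\Sigma=\{0,1\}$; strings are ordered in length-lexicographic order, and natural numbers are identified with strings in the standard way. For $A\subseteq\Sigma^*$, $\mathrm{rank}_A(y)=\|\{z\mid z\le y \wedge z\in A\}\|$. $A$ is strong-P-rankable if there is a total polynomial-time computable $f$ with $f(x)=\mathrm{rank}_A(x)$ for all $x\in\Sigma^*$. The join is $A\oplus B=\{x0\mid x\in A\}\cup\{x1\mid x\in B\}$. *)

theory Defs
  imports "HOL-Library.List_Lenlexorder" "HOL-Computational_Algebra.Polynomial"
begin

text \<open>
  Strings over the alphabet 0, 1 are of type \<^typ>\<open>bool list\<close>, with \<^const>\<open>False\<close> for 0 and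
  \<^const>\<open>True\<close> for 1. The imported order on lists is the length-lexicographic one, so
  \<^prop>\<open>x \<le> (y :: bool list)\<close> is the order on strings.
\<close>

definition rank :: "bool list set \<Rightarrow> bool list \<Rightarrow> nat" where
  "rank A y = card {z. z \<le> y \<and> z \<in> A}"

definition join :: "bool list set \<Rightarrow> bool list set \<Rightarrow> bool list set" where
  "join A B = {x @ [False] | x. x \<in> A} \<union> {x @ [True] | x. x \<in> B}"

text \<open>
  The standard identification of strings with natural numbers: the position of a string in the
  order, starting with 0 for the empty string.
\<close>

definition nat_of_string :: "bool list \<Rightarrow> nat" where
  "nat_of_string x = card {z. z < x}"

lemma finite_strings_less: "finite {z :: bool list. z < x}"
proof (rule finite_subset)
  show "{z. z < x} \<subseteq> {z. set z \<subseteq> UNIV \<and> length z \<le> length x}"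
    by (auto simp: list_less_def lenlex_conv)
  show "finite {z :: bool list. set z \<subseteq> UNIV \<and> length z \<le> length x}"
    by (rule finite_lists_length_le) simp
qed

lemma strict_mono_nat_of_string: "strict_mono nat_of_string"
proof (rule strict_monoI)
  fix x y :: "bool list"
  assume "x < y"
  then have "{z. z < x} \<subset> {z. z < y}"
    by auto
  then show "nat_of_string x < nat_of_string y"
    unfolding nat_of_string_def by (intro psubset_card_mono finite_strings_less)
qed

lemma bij_nat_of_string: "bij nat_of_string"
proof (rule bijI)
  show inj: "inj nat_of_string"
    by (rule strict_mono_imp_inj_on[OF strict_mono_nat_of_string])
  have segment: "nat_of_string ` {z. z < x} = {..<nat_of_string x}" for x
  proof (rule card_subset_eq)
    show "nat_of_string ` {z. z < x} \<subseteq> {..<nat_of_string x}"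
      using strict_mono_nat_of_string by (auto simp: strict_mono_def)
    have "card (nat_of_string ` {z. z < x}) = card {z. z < x}"
      using inj by (intro card_image) (auto intro: inj_on_subset)
    then show "card (nat_of_string ` {z. z < x}) = card {..<nat_of_string x}"
      by (simp add: nat_of_string_def)
  qed simp
  have "infinite (range nat_of_string)"
    using inj infinite_UNIV_listI finite_imageD by blast
  then have "\<exists>x. n < nat_of_string x" for n
    by (metis infinite_nat_iff_unbounded rangeE)
  then show "surj nat_of_string"
    using segment by blast
qed

text \<open>
  Deterministic multi-tape Turing machines. States are the numbers below \<open>tm_states\<close>, tape symbols
  the numbers below \<open>tm_symbols\<close>; symbol 0 is the blank, 1 and 2 stand for the bits 0 and 1.
  Given a state and the symbols under the heads, the transition function yields the next state and,
  for each tape, the symbol to write and the head movement.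
\<close>

datatype move = MoveLeft | Stay | MoveRight

record tm =
  tm_tapes :: nat
  tm_states :: nat
  tm_symbols :: nat
  tm_start :: nat
  tm_halt :: nat
  tm_delta :: "nat \<Rightarrow> nat list \<Rightarrow> nat \<times> (nat \<times> move) list"

definition wf_tm :: "tm \<Rightarrow> bool" where
  "wf_tm M \<longleftrightarrow>
     tm_tapes M \<ge> 1 \<and> tm_symbols M \<ge> 3 \<and>
     tm_start M < tm_states M \<and> tm_halt M < tm_states M \<and>
     (\<forall>q ss q' acts.
        q < tm_states M \<longrightarrow> length ss = tm_tapes M \<longrightarrow> set ss \<subseteq> {..<tm_symbols M} \<longrightarrow>
        tm_delta M q ss = (q', acts) \<longrightarrow>
        q' < tm_states M \<and> length acts = tm_tapes M \<and> fst ` set acts \<subseteq> {..<tm_symbols M})"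

text \<open>
  A tape is infinite in both directions and is described relative to its head, which always scans
  cell 0; moving the head shifts the contents.
\<close>

type_synonym tape = "int \<Rightarrow> nat"

fun shift_tape :: "move \<Rightarrow> tape \<Rightarrow> tape" where
  "shift_tape MoveLeft t = (\<lambda>i. t (i - 1))"
| "shift_tape Stay t = t"
| "shift_tape MoveRight t = (\<lambda>i. t (i + 1))"

definition act :: "nat \<times> move \<Rightarrow> tape \<Rightarrow> tape" where
  "act a t = shift_tape (snd a) (t(0 := fst a))"

type_synonym config = "nat \<times> tape list"

definition step :: "tm \<Rightarrow> config \<Rightarrow> config" where
  "step M c =
     (let (q, ts) = c in
      if q = tm_halt M then c
      else let (q', acts) = tm_delta M q (map (\<lambda>t. t 0) ts) in (q', map2 act acts ts))"

definition blank_tape :: tape where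
  "blank_tape = (\<lambda>_. 0)"

text \<open>The tape holding just a string, with the head on its first symbol.\<close>

definition string_tape :: "bool list \<Rightarrow> tape" where
  "string_tape x =
     (\<lambda>i. if 0 \<le> i \<and> i < int (length x) then (if x ! nat i then 2 else 1) else 0)"

definition init_config :: "tm \<Rightarrow> bool list \<Rightarrow> config" where
  "init_config M x = (tm_start M, string_tape x # replicate (tm_tapes M - 1) blank_tape)"

text \<open>
  The input is on the first tape and the output on the last one (the same tape if there is only
  one). On halting, the output tape holds nothing but the output and its head is on the first
  symbol of it.
\<close>

definition computes_in_time :: "tm \<Rightarrow> (bool list \<Rightarrow> bool list) \<Rightarrow> (nat \<Rightarrow> nat) \<Rightarrow> bool" where
  "computes_in_time M f T \<longleftrightarrow>
     (\<forall>x. \<exists>n \<le> T (length x). \<exists>ts.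
        (step M ^^ n) (init_config M x) = (tm_halt M, ts) \<and> last ts = string_tape (f x))"

definition polytime_computable :: "(bool list \<Rightarrow> bool list) \<Rightarrow> bool" where
  "polytime_computable f \<longleftrightarrow>
     (\<exists>M (p :: nat poly). wf_tm M \<and> computes_in_time M f (poly p))"

definition strong_P_rankable :: "bool list set \<Rightarrow> bool" where
  "strong_P_rankable A \<longleftrightarrow>
     (\<exists>f. polytime_computable f \<and> (\<forall>x. nat_of_string (f x) = rank A x))"

end

(*
  A nonempty string is x @ [b]. A string of the join is at most x @ [b] iff it is z @ [False] with
  z <= x, z in A, or z @ [True] with z in B and z <= x (if b) or z < x (if not b). Hence the rank of
  x @ [b] in the join is rank A x plus the rank in B of x or of its predecessor, respectively.
  The string with number n is the bijective base-2 numeral of n with digits 1, 2 written as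
  False, True. So one machine can split the input, decrement a copy of x if needed, simulate the two
  ranking machines side by side, and add their outputs as in school. A rank at x is at most the
  number of strings up to x, so the outputs have length at most length x + 1.
*)
theory Submission
  imports Defs
begin

section \<open>Strings as bijective binary numerals\<close>

lemma snoc_in_lex_iff:
  "length x = length y \<Longrightarrow> (x @ [a], y @ [b]) \<in> lex r \<longleftrightarrow> (x, y) \<in> lex r \<or> x = y \<and> (a, b) \<in> r"
  by (induction x y rule: list_induct2) auto

lemma snoc_less_snoc_iff:
  "x @ [a] < y @ [b] \<longleftrightarrow> x < y \<or> x = y \<and> a < (b::bool)"
  by (auto simp: list_less_def lenlex_conv snoc_in_lex_iff)

lemma snoc_le_snoc_iff:
  "x @ [a] \<le> y @ [b] \<longleftrightarrow> x < y \<or> x = y \<and> a \<le> (b::bool)"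
  unfolding order.order_iff_strict snoc_less_snoc_iff by auto

lemma Nil_less_snoc: "[] < x @ [a::bool]"
  by (simp add: list_less_def lenlex_conv)

text \<open>The values 1 and 2 are at once the digits of bijective base 2 and the tape symbols for
  the two bits; a blank then reads as 0.\<close>

fun digit :: "bool \<Rightarrow> nat" where
  "digit False = 1"
| "digit True = 2"

lemma digit_simps [simp]:
  "digit b \<noteq> 0" "0 \<noteq> digit b" "digit b = 1 \<longleftrightarrow> \<not> b" "digit b = Suc 0 \<longleftrightarrow> \<not> b"
  by (cases b; simp)+

lemma zero_notin_digits [simp]: "0 \<notin> digit ` S"
  by auto

lemma digit_cases: "digit b = 1 \<or> digit b = 2"
  by (cases b) simp_all

text \<open>Here and in \<open>rev_pred\<close> below, the least significant digit comes first.\<close>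

definition digits_val :: "nat list \<Rightarrow> nat" where
  "digits_val ds = foldr (\<lambda>d v. d + 2 * v) ds 0"

lemma digits_val_simps [simp]:
  "digits_val [] = 0"
  "digits_val (d # ds) = d + 2 * digits_val ds"
  by (simp_all add: digits_val_def)

lemma finite_strings_le: "finite {z :: bool list. z \<le> x}"
proof -
  have "{z. z \<le> x} = insert x {z. z < x}"
    by auto
  then show ?thesis
    by (simp add: finite_strings_less)
qed

lemma nat_of_string_Nil [simp]: "nat_of_string [] = 0"
  by (simp add: nat_of_string_def)

text \<open>Below \<open>x @ [b]\<close> lie the empty string, both extensions of every
  \<open>z < x\<close>, and \<open>x @ [False]\<close> if \<open>b\<close>. The empty string
  supplies the 1 contained in \<open>digit b\<close>.\<close>

lemma nat_of_string_snoc: "nat_of_string (x @ [b]) = digit b + 2 * nat_of_string x"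
proof -
  let ?S = "\<lambda>c. (\<lambda>z. z @ [c]) ` {z. z < x \<or> z = x \<and> \<not> c \<and> b}"
  have fin: "finite {z. z < x \<or> z = x \<and> \<not> c \<and> b}" for c
    by (rule finite_subset[OF _ finite_strings_le[of x]]) auto
  have "{z. z < x @ [b]} = insert [] (?S False \<union> ?S True)"
  proof (intro set_eqI)
    fix z show "z \<in> {z. z < x @ [b]} \<longleftrightarrow> z \<in> insert [] (?S False \<union> ?S True)"
    proof (cases z rule: rev_exhaust)
      case (snoc ys c)
      then show ?thesis by (cases c) (auto simp: snoc_less_snoc_iff image_iff)
    qed (simp add: Nil_less_snoc)
  qed
  moreover have "card (insert [] (?S False \<union> ?S True)) = Suc (card (?S False) + card (?S True))"
    using fin by (subst card_insert_disjoint) (auto intro!: card_Un_disjoint)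
  moreover have "card (?S c) = card {z. z < x \<or> z = x \<and> \<not> c \<and> b}" for c
    by (rule card_image) (simp add: inj_on_def)
  moreover have "{z. z < x \<or> z = x \<and> b} = (if b then insert x {z. z < x} else {z. z < x})"
    by auto
  ultimately show ?thesis
    by (simp only: nat_of_string_def) (simp add: finite_strings_less)
qed

lemma nat_of_string_eq: "nat_of_string x = digits_val (rev (map digit x))"
  by (induction x rule: rev_induct) (simp_all add: nat_of_string_snoc)

lemma nat_of_string_le_iff: "nat_of_string x \<le> nat_of_string y \<longleftrightarrow> x \<le> y"
  using strict_mono_nat_of_string by (rule strict_mono_less_eq)

lemma nat_of_string_less_iff: "nat_of_string x < nat_of_string y \<longleftrightarrow> x < y"
  using strict_mono_nat_of_string by (rule strict_mono_less)

lemma digits_of_string: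
  assumes "set ds \<subseteq> {1, 2}"
  shows "map digit (map (\<lambda>d. d = 2) ds) = ds"
  using assms by (induction ds) auto

section \<open>Predecessors of strings as decremented numerals\<close>

fun rev_pred :: "bool list \<Rightarrow> bool list" where
  "rev_pred [] = []"
| "rev_pred (True # l) = False # l"
| "rev_pred (False # l) = (if l = [] then [] else True # rev_pred l)"

text \<open>There is no digit 0, so lowering a 1 turns it into a 2 and borrows:
  \<open>1 + 2 * v - 1 = 2 + 2 * (v - 1)\<close>. A leading 1 vanishes instead.\<close>

lemma Suc_digits_val_rev_pred:
  "l \<noteq> [] \<Longrightarrow> Suc (digits_val (map digit (rev_pred l))) = digits_val (map digit l)"
  by (induction l rule: rev_pred.induct) auto

lemma length_rev_pred: "length (rev_pred l) \<le> length l"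
  by (induction l rule: rev_pred.induct) auto

text \<open>On a numeral of ones the borrow runs up to the leading digit and uses it up. This is the
  case for which phase \<open>Trim\<close> exists.\<close>

lemma rev_pred_no_True: "True \<notin> set l \<Longrightarrow> rev_pred l = replicate (length l - 1) True"
  by (induction l rule: rev_pred.induct) (auto simp: replicate_Suc[symmetric] simp del: replicate_Suc)

definition pred_string :: "bool list \<Rightarrow> bool list" where
  "pred_string x = rev (rev_pred (rev x))"

lemma length_pred_string: "length (pred_string x) \<le> length x"
  using length_rev_pred[of "rev x"] by (simp add: pred_string_def)

lemma le_pred_string_iff:
  assumes "x \<noteq> []"
  shows "z \<le> pred_string x \<longleftrightarrow> z < x"
proof -
  have "Suc (nat_of_string (pred_string x)) = nat_of_string x"
    using assms Suc_digits_val_rev_pred[of "rev x"]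
    by (simp add: nat_of_string_eq pred_string_def rev_map)
  then show ?thesis
    by (metis nat_of_string_le_iff nat_of_string_less_iff less_Suc_eq_le)
qed

section \<open>Ranks\<close>

text \<open>Keeps the final addition cheap: its cost is linear in the lengths of the two
  outputs.\<close>

lemma length_le_of_rank:
  assumes "nat_of_string w = rank A x"
  shows "length w \<le> Suc (length x)"
proof -
  \<comment> \<open>The first string that is longer than \<open>x\<close>.\<close>
  let ?y = "replicate (Suc (length x)) False"
  have "x < ?y"
    by (simp add: list_less_def lenlex_conv)
  then have "{z. z \<le> x \<and> z \<in> A} \<subseteq> {z. z < ?y}"
    by auto
  then have "rank A x \<le> nat_of_string ?y"
    unfolding rank_def nat_of_string_def by (rule card_mono[OF finite_strings_less])
  then have "w \<le> ?y"
    by (metis assms nat_of_string_le_iff)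
  then show ?thesis
    by (auto simp: list_le_def list_less_def lenlex_conv)
qed

lemma rank_join_Nil: "rank (join A B) [] = 0"
proof -
  have "{z. z \<le> [] \<and> z \<in> join A B} = {}"
    by (auto simp: join_def not_le Nil_less_snoc)
  then show ?thesis
    by (simp add: rank_def)
qed

lemma rank_join_snoc:
  "rank (join A B) (x @ [b]) =
     rank A x + (if b then rank B x else if x = [] then 0 else rank B (pred_string x))"
proof -
  let ?C = "{z. (z < x \<or> z = x \<and> b) \<and> z \<in> B}"
  have fin: "finite {z. z \<le> x \<and> z \<in> A}" "finite ?C"
    by (rule finite_subset[OF _ finite_strings_le[of x]]; auto)+
  have "{z. z \<le> x @ [b] \<and> z \<in> join A B} =
      (\<lambda>z. z @ [False]) ` {z. z \<le> x \<and> z \<in> A} \<union> (\<lambda>z. z @ [True]) ` ?C"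
    by (auto simp: join_def snoc_le_snoc_iff image_iff)
  then have "rank (join A B) (x @ [b]) = rank A x + card ?C"
  proof (simp only: rank_def)
    have "card ((\<lambda>z. z @ [False]) ` {z. z \<le> x \<and> z \<in> A} \<union> (\<lambda>z. z @ [True]) ` ?C) =
        card ((\<lambda>z. z @ [False]) ` {z. z \<le> x \<and> z \<in> A}) + card ((\<lambda>z. z @ [True]) ` ?C)"
      using fin by (intro card_Un_disjoint) auto
    then show "card ((\<lambda>z. z @ [False]) ` {z. z \<le> x \<and> z \<in> A} \<union> (\<lambda>z. z @ [True]) ` ?C) =
        card {z. z \<le> x \<and> z \<in> A} + card ?C"
      by (simp add: card_image inj_on_def)
  qed
  \<comment> \<open>\<open>pred_string []\<close> is again \<open>[]\<close>, at which the rank in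
    \<open>B\<close> is 1 if \<open>[]\<close> is in \<open>B\<close>; hence the separate case for
    empty \<open>x\<close>.\<close>
  moreover have "?C = (if b then {z. z \<le> x \<and> z \<in> B}
      else if x = [] then {} else {z. z \<le> pred_string x \<and> z \<in> B})"
    by (auto simp: le_pred_string_iff)
  ultimately show ?thesis
    by (simp add: rank_def)
qed

section \<open>Tapes\<close>

text \<open>The cells left of the head are listed from the head outwards.\<close>

definition tape_of :: "nat list \<Rightarrow> nat list \<Rightarrow> tape" where
  "tape_of l r = (\<lambda>i. if 0 \<le> i then nth_default 0 r (nat i) else nth_default 0 l (nat (- i - 1)))"

text \<open>Having the head one cell further left spares a case distinction on \<open>l\<close> in right-to-left passes.\<close>

definition left_of :: "nat list \<Rightarrow> nat list \<Rightarrow> tape" where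
  "left_of l r = (\<lambda>i. tape_of l r (i - 1))"

lemma nth_default_Cons_nat:
  "nth_default d (a # r) n = (if n = 0 then a else nth_default d r (n - 1))"
  by (cases n) simp_all

lemma tape_of_read [simp]:
  "tape_of l [] 0 = 0" "tape_of l (a # r) 0 = a"
  "left_of [] r 0 = 0" "left_of (a # l) r 0 = a"
  by (simp_all add: tape_of_def left_of_def nth_default_Cons_nat)

lemma blank_tape_read [simp]: "blank_tape 0 = 0"
  by (simp add: blank_tape_def)

lemma act_Stay [simp]: "t 0 = s \<Longrightarrow> act (s, Stay) t = t"
  by (auto simp: act_def)

lemma act_MoveRight_tape_of:
  "act (a, MoveRight) (tape_of l (a' # r)) = tape_of (a # l) r"
  by (auto simp: act_def tape_of_def nth_default_Cons_nat fun_eq_iff nat_diff_distrib' nat_add_distrib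
      intro!: arg_cong[where f = "nth_default 0 _"])

lemma act_erase_tape_of:
  "act (0, MoveRight) (tape_of [] r) = tape_of [] (tl r)"
  by (cases r) (auto simp: act_def tape_of_def nth_default_Cons_nat fun_eq_iff nat_diff_distrib' nat_add_distrib
      intro!: arg_cong[where f = "nth_default 0 _"])

lemma act_MoveLeft_end:
  "act (0, MoveLeft) (tape_of l []) = left_of l []"
  by (auto simp: act_def tape_of_def left_of_def fun_eq_iff)

text \<open>One equation serves both inside \<open>l\<close> and beyond its end, because
  \<open>tl [] = []\<close> and all cells past the list are blank.\<close>

lemma act_MoveLeft_left_of:
  "act (b, MoveLeft) (left_of l r) = left_of (tl l) (b # r)"
  by (cases l) (auto simp: act_def tape_of_def left_of_def nth_default_Cons_nat fun_eq_iff algebra_simps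
      intro!: arg_cong[where f = "nth_default 0 _"])

lemma act_MoveRight_left_of:
  "act (0, MoveRight) (left_of [] r) = tape_of [] r"
  by (auto simp: act_def tape_of_def left_of_def fun_eq_iff)

lemma blank_tape_eq: "blank_tape = left_of [] []" "blank_tape = tape_of [] []"
  by (auto simp: blank_tape_def left_of_def tape_of_def)

lemma string_tape_eq: "string_tape x = tape_of [] (map digit x)"
  by (auto simp: string_tape_def tape_of_def nth_default_def fun_eq_iff)

section \<open>Runs of the given machines\<close>

lemma poly_mono_nat: "m \<le> n \<Longrightarrow> poly p m \<le> poly p (n :: nat)"
  by (induction p) (auto intro!: add_mono mult_mono)

abbreviation scanned :: "tape list \<Rightarrow> nat list" where
  "scanned ts \<equiv> map (\<lambda>t. t 0) ts"

definition keep :: "nat list \<Rightarrow> (nat \<times> move) list" where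
  "keep ss = map (\<lambda>s. (s, Stay)) ss"

text \<open>A simulated machine has its input on its first tape and its output on its last; outside
  the simulation no other tape of it is changed.\<close>

definition on_first :: "nat \<times> move \<Rightarrow> nat list \<Rightarrow> (nat \<times> move) list" where
  "on_first a ss = a # keep (tl ss)"

definition on_last :: "nat \<times> move \<Rightarrow> nat list \<Rightarrow> (nat \<times> move) list" where
  "on_last a ss = keep (butlast ss) @ [a]"

lemma map2_act_keep [simp]: "map2 act (keep (scanned ts)) ts = ts"
  by (induction ts) (auto simp: keep_def)

lemma map2_act_keep_Cons [simp]:
  "t 0 = s \<Longrightarrow> map2 act (keep (s # scanned ts)) (t # ts) = t # ts"
  using map2_act_keep[of "t # ts"] by simp

lemma map2_act_on_first [simp]:
  "map2 act (on_first a (s # scanned ts)) (t # ts) = act a t # ts"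
  using map2_act_keep[of ts] by (simp add: on_first_def)

lemma map2_act_on_last [simp]:
  "map2 act (on_last a (scanned ts @ [s])) (ts @ [t]) = ts @ [act a t]"
  using map2_act_keep[of ts] by (simp add: on_last_def keep_def)

lemma length_acts [simp]:
  "length (keep ss) = length ss"
  "length (on_first a ss) = Suc (length ss - 1)"
  "length (on_last a ss) = Suc (length ss - 1)"
  by (simp_all add: keep_def on_first_def on_last_def)

definition writes_below :: "nat \<Rightarrow> (nat \<times> move) list \<Rightarrow> bool" where
  "writes_below n acts \<longleftrightarrow> fst ` set acts \<subseteq> {..<n}"

lemma writes_below_acts:
  assumes "set ss \<subseteq> {..<n}"
  shows "writes_below n (keep ss)"
    and "fst a < n \<Longrightarrow> writes_below n (on_first a ss)"
    and "fst a < n \<Longrightarrow> writes_below n (on_last a ss)"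
  using assms list.set_sel(2)[of ss]
  by (cases ss; auto simp: writes_below_def on_first_def on_last_def keep_def dest!: in_set_butlastD)+

text \<open>
  Well-formedness says nothing about \<^const>\<open>tm_delta\<close> outside the states and symbols of the machine,
  but a machine with a larger alphabet must be well-formed on all of its symbols.
\<close>

definition guarded_delta :: "tm \<Rightarrow> nat \<Rightarrow> nat list \<Rightarrow> nat \<times> (nat \<times> move) list" where
  "guarded_delta M q ss =
     (if q \<noteq> tm_halt M \<and> q < tm_states M \<and> length ss = tm_tapes M \<and> set ss \<subseteq> {..<tm_symbols M}
      then tm_delta M q ss else (q, keep ss))"

definition valid_config :: "tm \<Rightarrow> config \<Rightarrow> bool" where
  "valid_config M c \<longleftrightarrow> fst c < tm_states M \<and> length (snd c) = tm_tapes M \<and>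
     (\<forall>t\<in>set (snd c). \<forall>i. t i < tm_symbols M)"

text \<open>Either \<open>tm_delta\<close> is applied within its proper domain, or the symbols just
  read are written back. So any larger alphabet is respected too.\<close>

lemma guarded_delta_wf:
  assumes "wf_tm M" "guarded_delta M q ss = (q', acts)" "q < tm_states M" "length ss = tm_tapes M"
  shows "q' < tm_states M" "length acts = tm_tapes M"
    and "set ss \<subseteq> {..<n} \<Longrightarrow> tm_symbols M \<le> n \<Longrightarrow> writes_below n acts"
proof -
  have "q' < tm_states M \<and> length acts = tm_tapes M \<and>
    (set ss \<subseteq> {..<n} \<and> tm_symbols M \<le> n \<longrightarrow> writes_below n acts)"
  proof (cases "q \<noteq> tm_halt M \<and> set ss \<subseteq> {..<tm_symbols M}")
    case True
    then have "tm_delta M q ss = (q', acts)"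
      using assms(2-4) by (simp add: guarded_delta_def)
    then have "q' < tm_states M" "length acts = tm_tapes M" "fst ` set acts \<subseteq> {..<tm_symbols M}"
      using True assms(1,3,4) unfolding wf_tm_def by blast+
    then show ?thesis
      unfolding writes_below_def by fastforce
  next
    case False
    then have "guarded_delta M q ss = (q, keep ss)"
      unfolding guarded_delta_def by (intro if_not_P) blast
    then show ?thesis
      using assms(2-4) by (simp add: writes_below_acts)
  qed
  then show "q' < tm_states M" "length acts = tm_tapes M"
    and "set ss \<subseteq> {..<n} \<Longrightarrow> tm_symbols M \<le> n \<Longrightarrow> writes_below n acts"
    by blast+
qed

text \<open>In a valid configuration the guard can fail only in the halting state, where
  \<open>keep\<close> changes nothing and neither does \<open>step\<close>.\<close>

lemma guarded_delta_step:
  assumes "valid_config M (q, ts)" "guarded_delta M q (scanned ts) = (q', acts)"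
  shows "step M (q, ts) = (q', map2 act acts ts)"
proof -
  have "set (scanned ts) \<subseteq> {..<tm_symbols M}"
    using assms(1) by (auto simp: valid_config_def)
  then show ?thesis
    using assms by (auto simp: guarded_delta_def valid_config_def step_def split: if_splits)
qed

lemma act_less:
  assumes "\<And>i. t i < n" "fst a < n"
  shows "act a t i < n"
  using assms by (cases "snd a") (auto simp: act_def)

lemma valid_config_step:
  assumes "wf_tm M" "valid_config M c"
  shows "valid_config M (step M c)"
proof -
  obtain q ts where c: "c = (q, ts)" by fastforce
  obtain q' acts where d: "guarded_delta M q (scanned ts) = (q', acts)" by fastforce
  have v: "q < tm_states M" "length ts = tm_tapes M" "\<And>t i. t \<in> set ts \<Longrightarrow> t i < tm_symbols M"
    using assms(2) by (auto simp: c valid_config_def)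
  have "set (scanned ts) \<subseteq> {..<tm_symbols M}"
    using v(3) by auto
  then have w: "q' < tm_states M" "length acts = tm_tapes M" "fst ` set acts \<subseteq> {..<tm_symbols M}"
    using guarded_delta_wf[OF assms(1) d v(1)] v(2) by (auto simp: writes_below_def)
  have "act a t i < tm_symbols M" if "(a, t) \<in> set (zip acts ts)" for a t i
  proof (rule act_less)
    show "t i < tm_symbols M" for i
      using v(3) set_zip_rightD[OF that] by blast
    show "fst a < tm_symbols M"
      using w(3) set_zip_leftD[OF that] by blast
  qed
  then have "valid_config M (q', map2 act acts ts)"
    using v(2) w(1,2) by (auto simp: valid_config_def)
  then show ?thesis
    using guarded_delta_step assms(2) d by (simp add: c)
qed

text \<open>The state is left open because \<open>N\<close> is launched in its halting state when
  there is nothing to decrement.\<close>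

lemma valid_config_start:
  assumes "wf_tm M" "q < tm_states M"
  shows "valid_config M (q, string_tape x # replicate (tm_tapes M - 1) blank_tape)"
  using assms by (auto simp: valid_config_def wf_tm_def string_tape_def blank_tape_def)

lemma funpow_step_halt: "(step M ^^ n) (tm_halt M, ts) = (tm_halt M, ts)"
  by (induction n) (simp_all add: step_def)

text \<open>Brings the running times of two machines to a common value.\<close>

lemma funpow_step_halt_mono:
  assumes "(step M ^^ m) c = (tm_halt M, ts)" "m \<le> n"
  shows "(step M ^^ n) c = (tm_halt M, ts)"
proof -
  have "(step M ^^ ((n - m) + m)) c = (tm_halt M, ts)"
    unfolding funpow_add comp_apply assms(1) by (rule funpow_step_halt)
  then show ?thesis
    using assms(2) by simp
qed

section \<open>The machine for the join\<close>

text \<open>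
  The phases locate the last symbol of the input, split the rest into the inputs of the two
  machines (the flag of \<open>Copy\<close> is the borrow of a decrement of the second one, \<open>Trim\<close> removes a
  leading digit that a borrow has used up), run the machines in parallel, move to the last
  symbols of their outputs, and add these with a carry.
\<close>

datatype phase = Scan | Final | Copy bool | Trim | Run nat nat | Seek | Add nat | Halt

type_synonym join_config = "phase \<times> tape \<times> tape list \<times> tape list \<times> tape"

locale join_machine =
  fixes M N :: tm
  assumes wf: "wf_tm M" "wf_tm N"
begin

text \<open>
  The arguments are the symbols on the input tape, the tapes of \<open>M\<close>, those of \<open>N\<close>, and the output
  tape. In phase \<open>Add\<close>, the value of a symbol is that of the digit it stands for, with 0 for a blank.
  In phase \<open>Trim\<close>, a blank means that there was no string to decrement; \<open>N\<close> is then skipped.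
\<close>

fun trans :: "phase \<Rightarrow> nat \<Rightarrow> nat list \<Rightarrow> nat list \<Rightarrow> nat \<Rightarrow>
    phase \<times> (nat \<times> move) \<times> (nat \<times> move) list \<times> (nat \<times> move) list \<times> (nat \<times> move)" where
  "trans Scan i ss us x =
     (if i = 0 then (Final, (0, MoveLeft), keep ss, keep us, (x, Stay))
      else (Scan, (i, MoveRight), keep ss, keep us, (x, Stay)))"
| "trans Final i ss us x =
     (if i = 0 then (Halt, (i, Stay), keep ss, keep us, (x, Stay))
      else (Copy (i = 1), (i, MoveLeft), keep ss, keep us, (x, Stay)))"
| "trans (Copy c) i ss us x =
     (if i = 0 then
        (if c then Trim else Run (tm_start M) (tm_start N),
         (i, Stay), on_first (0, MoveRight) ss, on_first (0, MoveRight) us, (x, Stay))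
      else
        (Copy (c \<and> i = 1), (i, MoveLeft), on_first (i, MoveLeft) ss,
         on_first (if c then if i = 1 then 2 else 1 else i, MoveLeft) us, (x, Stay)))"
| "trans Trim i ss us x =
     (Run (tm_start M) (if hd us = 0 then tm_halt N else tm_start N),
      (i, Stay), keep ss, on_first (0, MoveRight) us, (x, Stay))"
| "trans (Run p q) i ss us x =
     (if p = tm_halt M \<and> q = tm_halt N then (Seek, (i, Stay), keep ss, keep us, (x, Stay))
      else
        (let (p', as) = guarded_delta M p ss; (q', bs) = guarded_delta N q us
         in (Run p' q', (i, Stay), as, bs, (x, Stay))))"
| "trans Seek i ss us x =
     (if last ss = 0 \<and> last us = 0
      then (Add 0, (i, Stay), on_last (0, MoveLeft) ss, on_last (0, MoveLeft) us, (x, Stay))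
      else
        (Seek, (i, Stay), on_last (last ss, if last ss = 0 then Stay else MoveRight) ss,
         on_last (last us, if last us = 0 then Stay else MoveRight) us, (x, Stay)))"
| "trans (Add c) i ss us x =
     (let n = last ss + last us + c in
      if n = 0 then (Halt, (i, Stay), keep ss, keep us, (0, MoveRight))
      else
        (Add (min 2 ((n - 1) div 2)), (i, Stay), on_last (last ss, MoveLeft) ss,
         on_last (last us, MoveLeft) us, (2 - n mod 2, MoveLeft)))"
| "trans Halt i ss us x = (Halt, (i, Stay), keep ss, keep us, (x, Stay))"

fun advance :: "join_config \<Rightarrow> join_config" where
  "advance (q, i, ts, us, x) =
     (case trans q (i 0) (scanned ts) (scanned us) (x 0) of
        (q', a, as, bs, b) \<Rightarrow> (q', act a i, map2 act as ts, map2 act bs us, act b x))"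

text \<open>\<open>computes_in_time\<close> asks only for an upper bound on the steps, and such
  bounds can be rounded up when runs are chained.\<close>

definition reaches :: "nat \<Rightarrow> join_config \<Rightarrow> join_config \<Rightarrow> bool" where
  "reaches n c d \<longleftrightarrow> (\<exists>m\<le>n. (advance ^^ m) c = d)"

lemma reaches_refl: "reaches n c c"
  unfolding reaches_def by (intro exI[of _ 0]) simp

lemma reaches_step:
  assumes "reaches n (advance c) d"
  shows "reaches (Suc n) c d"
  using assms unfolding reaches_def by (metis Suc_le_mono comp_apply funpow_Suc_right)

lemma reaches_trans:
  assumes "reaches m c d" "reaches n d e" "m + n \<le> k"
  shows "reaches k c e"
proof -
  obtain i j where "i \<le> m" "(advance ^^ i) c = d" "j \<le> n" "(advance ^^ j) d = e"
    using assms(1,2) by (auto simp: reaches_def)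
  then have "(advance ^^ (j + i)) c = e" "j + i \<le> k"
    using assms(3) by (auto simp: funpow_add)
  then show ?thesis
    by (auto simp: reaches_def)
qed

subsection \<open>Preparing the inputs\<close>

lemma reaches_Scan:
  "0 \<notin> set r \<Longrightarrow>
   reaches (Suc (length r)) (Scan, tape_of l r, ts, us, x) (Final, left_of (rev r @ l) [], ts, us, x)"
proof (induction r arbitrary: l)
  case Nil
  show ?case
    by (rule reaches_step) (simp add: act_MoveLeft_end reaches_refl)
next
  case (Cons a r)
  have "reaches (Suc (length r)) (advance (Scan, tape_of l (a # r), ts, us, x))
    (Final, left_of (rev r @ a # l) [], ts, us, x)"
    using Cons.IH[of "a # l"] Cons.prems by (simp add: act_MoveRight_tape_of)
  from reaches_step[OF this] show ?case
    by simp
qed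

text \<open>All heads move left together, so the least significant digit is copied first and each
  copy grows at its front.\<close>

lemma reaches_Copy_no_borrow:
  "reaches (length l)
     (Copy False, left_of (map digit l) r, left_of [] w # ts, left_of [] v # us, x)
     (Copy False, left_of [] (rev (map digit l) @ r), left_of [] (rev (map digit l) @ w) # ts,
      left_of [] (rev (map digit l) @ v) # us, x)"
proof (induction l arbitrary: r w v)
  case (Cons a l)
  show ?case
    using reaches_step[of "length l" "(Copy False, left_of (map digit (a # l)) r,
        left_of [] w # ts, left_of [] v # us, x)"]
      Cons.IH[of "digit a # r" "digit a # w" "digit a # v"]
    by (simp add: act_MoveLeft_left_of del: split_paired_All)
qed (simp add: reaches_refl)

text \<open>Ones become twos until the first 2 absorbs the borrow; from there on copying is plain.
  Without any 2 the borrow survives to the end.\<close>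

lemma reaches_Copy_borrow:
  "reaches (length l)
     (Copy True, left_of (map digit l) r, left_of [] w # ts, left_of [] v # us, x)
     (Copy (True \<notin> set l), left_of [] (rev (map digit l) @ r),
      left_of [] (rev (map digit l) @ w) # ts,
      left_of [] ((if True \<in> set l then rev (map digit (rev_pred l)) else replicate (length l) 2) @ v)
        # us, x)"
proof (induction l arbitrary: r w v)
  case (Cons a l)
  show ?case
  proof (cases a)
    case True
    then show ?thesis
      using reaches_step[of "length l" "(Copy True, left_of (map digit (a # l)) r,
          left_of [] w # ts, left_of [] v # us, x)"]
        reaches_Copy_no_borrow[of l "2 # r" "2 # w" ts "1 # v" us x]
      by (simp add: act_MoveLeft_left_of)
  next
    case False
    have "l \<noteq> []" if "True \<in> set l"
      using that by auto
    then show ?thesis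
      using reaches_step[of "length l" "(Copy True, left_of (map digit (a # l)) r,
          left_of [] w # ts, left_of [] v # us, x)"]
        Cons.IH[of "1 # r" "1 # w" "2 # v"] False
      by (auto simp: act_MoveLeft_left_of replicate_app_Cons_same split: if_splits)
  qed
qed (simp add: reaches_refl)

lemma reaches_prepare:
  defines "T \<equiv> replicate (tm_tapes M - 1) blank_tape" and "U \<equiv> replicate (tm_tapes N - 1) blank_tape"
  obtains i where "reaches (2 * length x + 5)
    (Scan, string_tape (x @ [b]), replicate (tm_tapes M) blank_tape,
      replicate (tm_tapes N) blank_tape, blank_tape)
    (Run (tm_start M) (if \<not> b \<and> x = [] then tm_halt N else tm_start N), i,
      string_tape x # T, string_tape (if b then x else pred_string x) # U, blank_tape)"
proof -
  let ?ts = "left_of [] [] # T" and ?us = "left_of [] [] # U" and ?l = "map digit (rev x)"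
  let ?c = "(Copy (\<not> b), left_of ?l [digit b], ?ts, ?us, blank_tape)"
  have start: "replicate (tm_tapes M) blank_tape = ?ts" "replicate (tm_tapes N) blank_tape = ?us"
    using wf unfolding T_def U_def blank_tape_eq(1)[symmetric] wf_tm_def
    by (auto simp flip: replicate_Suc)
  have "reaches (length x + 2)
      (Scan, string_tape (x @ [b]), ?ts, ?us, blank_tape) (Final, left_of (digit b # ?l) [], ?ts, ?us, blank_tape)"
    using reaches_Scan[of "map digit (x @ [b])" "[]" ?ts ?us blank_tape]
    by (auto simp: string_tape_eq rev_map)
  moreover have "reaches 1 (Final, left_of (digit b # ?l) [], ?ts, ?us, blank_tape) ?c"
    using reaches_step[of 0 "(Final, left_of (digit b # ?l) [], ?ts, ?us, blank_tape)" ?c]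
      map2_act_keep[of T] map2_act_keep[of U]
    by (auto simp: act_MoveLeft_left_of reaches_refl keep_def)
  ultimately have A: "reaches (length x + 3) (Scan, string_tape (x @ [b]), ?ts, ?us, blank_tape) ?c"
    by (rule reaches_trans) simp
  let ?w = "map digit x" and ?i = "left_of [] (map digit (x @ [b]))"
  let ?goal = "\<lambda>i. (Run (tm_start M) (if \<not> b \<and> x = [] then tm_halt N else tm_start N), i,
      string_tape x # T, string_tape (if b then x else pred_string x) # U, blank_tape)"
  have B: "reaches (length x + 2) ?c (?goal ?i)"
  \<comment> \<open>Whether the borrow is gone after copying. If so, \<open>Copy\<close> enters
    \<open>Run\<close> directly, otherwise by way of \<open>Trim\<close>.\<close>
  proof (cases "b \<or> True \<in> set x")
    case True
    let ?v = "map digit (if b then x else pred_string x)"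
    let ?d = "(Copy False, ?i, left_of [] ?w # T, left_of [] ?v # U, blank_tape)"
    have "reaches (length x) ?c ?d"
    proof (cases b)
      case True
      then show ?thesis
        using reaches_Copy_no_borrow[of "rev x" "[digit b]" "[]" T "[]" U blank_tape]
        by (simp add: rev_map)
    next
      case False
      then show ?thesis
        using reaches_Copy_borrow[of "rev x" "[digit b]" "[]" T "[]" U blank_tape] True
        by (simp add: rev_map pred_string_def)
    qed
    moreover have "advance ?d = ?goal ?i"
      using True by (auto simp: act_MoveRight_left_of string_tape_eq)
    then have "reaches 1 ?d (?goal ?i)"
      using reaches_step[of 0 ?d] by (simp add: reaches_refl)
    ultimately show ?thesis
      by (rule reaches_trans) simp
  next
    case False
    let ?d = "(Copy True, ?i, left_of [] ?w # T, left_of [] (replicate (length x) 2) # U, blank_tape)"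
    have "reaches (length x) ?c ?d"
      using reaches_Copy_borrow[of "rev x" "[digit b]" "[]" T "[]" U blank_tape] False
      by (simp add: rev_map)
    \<comment> \<open>The copy consists of twos and has one digit too many, which
      \<open>Trim\<close> erases. For empty \<open>x\<close> it reads a blank, and \<open>tl\<close>
      leaves the empty list alone.\<close>
    moreover have "map digit (pred_string x) = tl (replicate (length x) 2)"
      using False rev_pred_no_True[of "rev x"] by (cases "length x") (simp_all add: pred_string_def)
    then have "advance (advance ?d) = ?goal ?i"
      using False by (cases x) (auto simp: act_MoveRight_left_of act_erase_tape_of string_tape_eq)
    then have "reaches 2 ?d (?goal ?i)"
      using reaches_step[of 1 ?d] reaches_step[of 0 "advance ?d"] reaches_refl[of 0]
      by (metis One_nat_def Suc_1)
    ultimately show ?thesis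
      by (rule reaches_trans) simp
  qed
  show ?thesis
    by (rule that[of ?i], unfold start, rule reaches_trans[OF A B]) simp
qed

subsection \<open>Running the machines\<close>

lemma advance_Run:
  assumes "valid_config M (p, ts)" "valid_config N (q, us)" "\<not> (p = tm_halt M \<and> q = tm_halt N)"
    and "step M (p, ts) = (p', ts')" "step N (q, us) = (q', us')"
  shows "advance (Run p q, i, ts, us, x) = (Run p' q', i, ts', us', x)"
proof -
  obtain p'' as where p: "guarded_delta M p (scanned ts) = (p'', as)" by fastforce
  obtain q'' bs where q: "guarded_delta N q (scanned us) = (q'', bs)" by fastforce
  have "advance (Run p q, i, ts, us, x) = (Run p'' q'', i, map2 act as ts, map2 act bs us, x)"
    using assms(3) by (auto simp: p q)
  then show ?thesis
    using guarded_delta_step[OF assms(1) p] guarded_delta_step[OF assms(2) q] assms(4,5) by simp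
qed

text \<open>A machine that halts first idles until the other one is done. If both halt before
  \<open>n\<close> steps, the phase just ends earlier.\<close>

lemma reaches_Run:
  assumes "valid_config M (p, ts)" "valid_config N (q, us)"
    and "(step M ^^ n) (p, ts) = (tm_halt M, ts')" "(step N ^^ n) (q, us) = (tm_halt N, us')"
  shows "reaches n (Run p q, i, ts, us, x) (Run (tm_halt M) (tm_halt N), i, ts', us', x)"
  using assms
proof (induction n arbitrary: p ts q us)
  case 0
  then show ?case by (simp add: reaches_refl)
next
  case (Suc n)
  show ?case
  proof (cases "p = tm_halt M \<and> q = tm_halt N")
    case True
    then show ?thesis
      using Suc.prems(3,4) unfolding funpow_step_halt[of "Suc n"] by (simp add: funpow_step_halt reaches_refl del: funpow.simps)
  next
    case False
    obtain p' ts1 where p: "step M (p, ts) = (p', ts1)" by fastforce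
    obtain q' us1 where q: "step N (q, us) = (q', us1)" by fastforce
    have "reaches n (Run p' q', i, ts1, us1, x) (Run (tm_halt M) (tm_halt N), i, ts', us', x)"
    proof (rule Suc.IH)
      show "valid_config M (p', ts1)" "valid_config N (q', us1)"
        using valid_config_step[OF wf(1) Suc.prems(1)] valid_config_step[OF wf(2) Suc.prems(2)]
        by (simp_all add: p q)
      show "(step M ^^ n) (p', ts1) = (tm_halt M, ts')" "(step N ^^ n) (q', us1) = (tm_halt N, us')"
        using Suc.prems(3,4) by (simp_all add: funpow_Suc_right p q del: funpow.simps)
    qed
    then show ?thesis
      by (intro reaches_step) (simp only: advance_Run[OF Suc.prems(1,2) False p q])
  qed
qed

subsection \<open>Adding the outputs\<close>

text \<open>The two outputs may differ in length; a head that has reached its blank waits. Each step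
  shortens at least one remainder, hence the induction on the sum of lengths.\<close>

lemma reaches_Seek:
  assumes "0 \<notin> set r" "0 \<notin> set r'"
  shows "reaches (Suc (length r + length r'))
    (Seek, i, ts @ [tape_of l r], us @ [tape_of l' r'], x)
    (Add 0, i, ts @ [left_of (rev r @ l) []], us @ [left_of (rev r' @ l') []], x)"
  using assms
proof (induction "length r + length r'" arbitrary: l r l' r' rule: less_induct)
  case less
  let ?c = "(Seek, i, ts @ [tape_of l r], us @ [tape_of l' r'], x)"
  show ?case
  proof (cases "r = [] \<and> r' = []")
    case True
    then show ?thesis
      by (intro reaches_step) (simp add: act_MoveLeft_end reaches_refl)
  next
    case False
    have len: "Suc (length (drop 1 r) + length (drop 1 r')) \<le> length r + length r'"
      using False by (cases r; cases r') auto
    \<comment> \<open>For an exhausted \<open>r\<close> both \<open>take 1 r\<close> and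
      \<open>drop 1 r\<close> are empty, so this describes a waiting head as well as a moving
      one.\<close>
    let ?m = "\<lambda>l r. tape_of (rev (take 1 r) @ l) (drop 1 r)"
    have step: "advance ?c = (Seek, i, ts @ [?m l r], us @ [?m l' r'], x)"
      using False less.prems by (cases r; cases r') (auto simp: act_MoveRight_tape_of)
    have rev_eq: "rev (drop 1 s) @ rev (take 1 s) @ k = rev s @ k" for s k :: "nat list"
      by (cases s) auto
    have "reaches (Suc (length (drop 1 r) + length (drop 1 r')))
        (Seek, i, ts @ [?m l r], us @ [?m l' r'], x)
        (Add 0, i, ts @ [left_of (rev (drop 1 r) @ rev (take 1 r) @ l) []],
          us @ [left_of (rev (drop 1 r') @ rev (take 1 r') @ l') []], x)"
      using len less.prems by (intro less.hyps) (auto dest: in_set_dropD)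
    then have "reaches (Suc (length (drop 1 r) + length (drop 1 r'))) (advance ?c)
        (Add 0, i, ts @ [left_of (rev r @ l) []], us @ [left_of (rev r' @ l') []], x)"
      unfolding step rev_eq .
    then show ?thesis
      by (rule reaches_trans[OF reaches_step reaches_refl[of 0]]) (use len in simp)
  qed
qed

lemma left_of_read: "left_of l r 0 = nth_default 0 l 0"
  by (cases l) simp_all

text \<open>A positive column sum \<open>n\<close> is split as \<open>d + 2 * c'\<close> with a
  digit \<open>d\<close> in {1, 2} of the same parity as \<open>n\<close>. Since \<open>n\<close> is
  at most 6, the carry stays at most 2. Column sum 0 means that both numerals and the carry are used
  up.\<close>

lemma reaches_Add:
  assumes "set k \<subseteq> {1, 2}" "set l \<subseteq> {1, 2}" "c \<le> 2"
  shows "\<exists>ds ts' us'. set ds \<subseteq> {1, 2} \<and> digits_val ds = digits_val k + digits_val l + c \<and>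
    reaches (Suc (length k + length l + c))
      (Add c, i, ts @ [left_of k r], us @ [left_of l r'], left_of [] w)
      (Halt, i, ts', us', tape_of [] (rev ds @ w))"
  using assms
proof (induction "length k + length l + c" arbitrary: k l c r r' w rule: less_induct)
  case less
  \<comment> \<open>The default 0 is the blank read beyond the end of a numeral.\<close>
  define a b where "a = nth_default 0 k 0" and "b = nth_default 0 l 0"
  define n where "n = a + b + c"
  let ?c = "(Add c, i, ts @ [left_of k r], us @ [left_of l r'], left_of [] w)"
  have k: "digits_val k = a + 2 * digits_val (tl k)" "a \<le> 2" "k = [] \<longleftrightarrow> a = 0"
    using less.prems(1) by (cases k; auto simp: a_def)+
  have l: "digits_val l = b + 2 * digits_val (tl l)" "b \<le> 2" "l = [] \<longleftrightarrow> b = 0"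
    using less.prems(2) by (cases l; auto simp: b_def)+
  show ?case
  proof (cases "n = 0")
    case True
    then have "k = []" "l = []" "c = 0"
      using k l by (auto simp: n_def)
    then show ?thesis
      by (intro exI[of _ "[]"] exI conjI reaches_step)
        (auto simp: act_MoveRight_left_of Let_def intro: reaches_refl)
  next
    case False
    define c' where "c' = (n - 1) div 2"
    define d where "d = 2 - n mod 2"
    have c': "c' \<le> 2" "d \<in> {1, 2}"
      using False less.prems(3) k(2) l(2) unfolding c'_def d_def n_def by auto
    have sum: "d + 2 * c' = n"
      using False unfolding c'_def d_def by presburger
    have step: "advance ?c = (Add c', i, ts @ [left_of (tl k) (a # r)], us @ [left_of (tl l) (b # r')],
        left_of [] (d # w))"
      using False c'(1) unfolding c'_def d_def n_def a_def b_def
      by (simp add: left_of_read act_MoveLeft_left_of Let_def min_absorb2)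
    \<comment> \<open>The carry grows by at most 1, and only if both numerals lose a digit; once
      both are exhausted, it shrinks.\<close>
    have "length (tl k) + length (tl l) + c' < length k + length l + c"
      using False less.prems(3) k(2,3) l(2,3) unfolding c'_def n_def
      by (cases k; cases l) auto
    moreover have "set (tl k) \<subseteq> {1, 2}" "set (tl l) \<subseteq> {1, 2}"
      using less.prems(1,2) by (cases k; cases l; simp)+
    ultimately obtain ds ts' us' where ds: "set ds \<subseteq> {1, 2}"
      "digits_val ds = digits_val (tl k) + digits_val (tl l) + c'"
      "reaches (Suc (length (tl k) + length (tl l) + c')) (advance ?c)
        (Halt, i, ts', us', tape_of [] (rev ds @ d # w))"
      using less.hyps c'(1) unfolding step by metis
    show ?thesis
    proof (intro exI conjI)
      show "set (d # ds) \<subseteq> {1, 2}"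
        using ds(1) c'(2) by auto
      show "digits_val (d # ds) = digits_val k + digits_val l + c"
        using ds(2) sum k(1) l(1) by (simp add: n_def)
      show "reaches (Suc (length k + length l + c)) ?c (Halt, i, ts', us', tape_of [] (rev (d # ds) @ w))"
        using reaches_trans[OF reaches_step[OF ds(3)] reaches_refl[of 0]]
          \<open>length (tl k) + length (tl l) + c' < length k + length l + c\<close>
        by simp
    qed
  qed
qed

lemma reaches_sum:
  assumes "last ts = string_tape x" "last us = string_tape y" "ts \<noteq> []" "us \<noteq> []"
    and "nat_of_string z = nat_of_string x + nat_of_string y"
  obtains ts' us' where "reaches (2 * (length x + length y) + 3)
    (Run (tm_halt M) (tm_halt N), i, ts, us, blank_tape) (Halt, i, ts', us', string_tape z)"
proof -
  let ?r = "map digit x" and ?s = "map digit y"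
  let ?T = "butlast ts" and ?U = "butlast us"
  let ?c = "(Run (tm_halt M) (tm_halt N), i, ts, us, blank_tape)"
  have eq: "ts = ?T @ [tape_of [] ?r]" "us = ?U @ [tape_of [] ?s]"
    using assms(1-4) by (metis append_butlast_last_id string_tape_eq)+
  have "reaches (Suc (length x + length y)) (Seek, i, ts, us, blank_tape)
      (Add 0, i, ?T @ [left_of (rev ?r) []], ?U @ [left_of (rev ?s) []], left_of [] [])"
    using reaches_Seek[of ?r ?s i ?T "[]" ?U "[]" blank_tape] eq(1,2)
    by (auto simp: blank_tape_eq(1))
  moreover have "advance ?c = (Seek, i, ts, us, blank_tape)"
    by simp
  ultimately have A: "reaches (Suc (Suc (length x + length y))) ?c
      (Add 0, i, ?T @ [left_of (rev ?r) []], ?U @ [left_of (rev ?s) []], left_of [] [])"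
    by (metis reaches_step)
  have "set (rev (map digit v)) \<subseteq> {1, 2}" for v
    using digit_cases by auto
  then obtain ds ts' us' where ds: "set ds \<subseteq> {1, 2}"
    "digits_val ds = digits_val (rev ?r) + digits_val (rev ?s) + 0"
    "reaches (Suc (length (rev ?r) + length (rev ?s) + 0))
      (Add 0, i, ?T @ [left_of (rev ?r) []], ?U @ [left_of (rev ?s) []], left_of [] [])
      (Halt, i, ts', us', tape_of [] (rev ds @ []))"
    using reaches_Add[of "rev ?r" "rev ?s" 0 i ?T "[]" ?U "[]" "[]"] by blast
  define z' where "z' = map (\<lambda>d. d = 2) (rev ds)"
  have z': "map digit z' = rev ds"
    unfolding z'_def using ds(1) by (intro digits_of_string) simp
  then have "nat_of_string z' = nat_of_string z"
    using ds(2) by (simp add: nat_of_string_eq[of z'] assms(5) nat_of_string_eq[of x] nat_of_string_eq[of y])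
  \<comment> \<open>The digits written spell some string \<open>z'\<close>; the numbering is
    injective, so it is the wanted one.\<close>
  then have "z' = z"
    using bij_nat_of_string by (metis bij_is_inj injD)
  then have "reaches (Suc (length x + length y))
      (Add 0, i, ?T @ [left_of (rev ?r) []], ?U @ [left_of (rev ?s) []], left_of [] [])
      (Halt, i, ts', us', string_tape z)"
    using ds(3) z' by (simp add: string_tape_eq)
  with A have "reaches (2 * (length x + length y) + 3) ?c (Halt, i, ts', us', string_tape z)"
    by (rule reaches_trans) simp
  then show ?thesis
    by (rule that)
qed

subsection \<open>Total running time\<close>

lemma valid_config_funpow:
  "wf_tm K \<Longrightarrow> valid_config K c \<Longrightarrow> valid_config K ((step K ^^ n) c)"
  by (induction n) (simp_all add: valid_config_step)

lemma reaches_join: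
  assumes f: "computes_in_time M f (poly p)" "length (f x) \<le> Suc (length x)"
    and g: "computes_in_time N g (poly q)" "\<And>x. length (g x) \<le> Suc (length x)"
    and z: "nat_of_string z = nat_of_string (f x) +
      (if b then nat_of_string (g x) else if x = [] then 0 else nat_of_string (g (pred_string x)))"
  obtains i ts us where "reaches (poly (p + q + [:12, 6:]) (length (x @ [b])))
    (Scan, string_tape (x @ [b]), replicate (tm_tapes M) blank_tape,
      replicate (tm_tapes N) blank_tape, blank_tape)
    (Halt, i, ts, us, string_tape z)"
proof -
  define x' where "x' = (if b then x else pred_string x)"
  define y where "y = (if \<not> b \<and> x = [] then [] else g x')"
  define r where "r = (if \<not> b \<and> x = [] then tm_halt N else tm_start N)"
  let ?T = "string_tape x # replicate (tm_tapes M - 1) blank_tape"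
  let ?U = "string_tape x' # replicate (tm_tapes N - 1) blank_tape"
  have x': "length x' \<le> length x"
    by (simp add: x'_def length_pred_string)
  have y: "length y \<le> Suc (length x)"
    using g(2)[of x'] x' by (auto simp: y_def)
  have vM: "valid_config M (tm_start M, ?T)" and vN: "valid_config N (r, ?U)"
    using wf unfolding wf_tm_def r_def by (intro valid_config_start wf; simp)+
  obtain m ts where m: "m \<le> poly p (length x)" "(step M ^^ m) (tm_start M, ?T) = (tm_halt M, ts)"
    "last ts = string_tape (f x)"
    using f(1) unfolding computes_in_time_def init_config_def by blast
  obtain n us where n: "n \<le> poly q (length x)" "(step N ^^ n) (r, ?U) = (tm_halt N, us)"
    "last us = string_tape y"
  proof (cases "\<not> b \<and> x = []")
    case True
    \<comment> \<open>All tapes of the skipped machine are blank, and a blank output tape stands for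
      the empty string, that is, for 0.\<close>
    have "last ?U = string_tape y"
      using True by (simp add: x'_def y_def pred_string_def string_tape_eq blank_tape_eq(2))
    with True show ?thesis
      by (intro that[of 0 ?U]) (simp_all add: r_def)
  next
    case False
    then have "r = tm_start N" "y = g x'"
      unfolding r_def y_def by argo+
    moreover obtain n us where "n \<le> poly q (length x')"
      "(step N ^^ n) (tm_start N, ?U) = (tm_halt N, us)" "last us = string_tape (g x')"
      using g(1) unfolding computes_in_time_def init_config_def by blast
    ultimately show ?thesis
      using poly_mono_nat[OF x', of q] by (intro that[of n us]) auto
  qed
  have "length ts = tm_tapes M" "length us = tm_tapes N"
    using valid_config_funpow[OF wf(1) vM, of m] valid_config_funpow[OF wf(2) vN, of n] m(2) n(2)
    by (simp_all add: valid_config_def)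
  then have ne: "ts \<noteq> []" "us \<noteq> []"
    using wf by (auto simp: wf_tm_def)
  have "nat_of_string z = nat_of_string (f x) + nat_of_string y"
    using z by (simp add: y_def x'_def)
  note sum = reaches_sum[OF m(3) n(3) ne this]
  obtain i where i: "reaches (2 * length x + 5)
    (Scan, string_tape (x @ [b]), replicate (tm_tapes M) blank_tape,
      replicate (tm_tapes N) blank_tape, blank_tape)
    (Run (tm_start M) r, i, ?T, ?U, blank_tape)"
    using reaches_prepare[of x b] unfolding r_def x'_def by blast
  obtain ts' us' where fin: "reaches (2 * (length (f x) + length y) + 3)
    (Run (tm_halt M) (tm_halt N), i, ts, us, blank_tape) (Halt, i, ts', us', string_tape z)"
    using sum by blast
  have run: "reaches (m + n) (Run (tm_start M) r, i, ?T, ?U, blank_tape)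
      (Run (tm_halt M) (tm_halt N), i, ts, us, blank_tape)"
    using vM vN by (rule reaches_Run; intro funpow_step_halt_mono[OF m(2)] funpow_step_halt_mono[OF n(2)]; simp)
  have "poly p (length x) \<le> poly p (Suc (length x))" "poly q (length x) \<le> poly q (Suc (length x))"
    by (simp_all add: poly_mono_nat)
  \<comment> \<open>Both outputs have length at most \<open>length x + 1\<close>, so everything but
    the simulation takes at most \<open>6 * length x + 12\<close> steps.\<close>
  then have "2 * length x + 5 + (m + n) + (2 * (length (f x) + length y) + 3)
      \<le> poly (p + q + [:12, 6:]) (length (x @ [b]))"
    using m(1) n(1) f(2) y by simp
  then show ?thesis
    using reaches_trans[OF reaches_trans[OF i run order.refl] fin] that by blast
qed

subsection \<open>Encoding the phases\<close>

text \<open>The type \<open>phase\<close> is infinite; this finite part of it is closed under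
  \<open>trans\<close> and becomes the state set.\<close>

definition phases :: "phase set" where
  "phases = {Scan, Final, Copy False, Copy True, Trim, Seek, Halt} \<union> Add ` {..2} \<union>
     (\<lambda>(p, q). Run p q) ` ({..<tm_states M} \<times> {..<tm_states N})"

text \<open>Any numbering will do, as the states of a machine are bare numbers below a
  bound.\<close>

definition code :: "phase \<Rightarrow> nat" where
  "code = (SOME h. bij_betw h phases {0..<card phases})"

lemma bij_code: "bij_betw code phases {0..<card phases}"
proof -
  have "finite phases"
    by (simp add: phases_def)
  then show ?thesis
    unfolding code_def by (rule someI_ex[OF ex_bij_betw_finite_nat])
qed

definition decode :: "nat \<Rightarrow> phase" where
  "decode = inv_into phases code"

lemma decode_code: "q \<in> phases \<Longrightarrow> decode (code q) = q"
  using bij_code unfolding decode_def bij_betw_def by (metis inv_into_f_f)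

lemma decode_in_phases: "n < card phases \<Longrightarrow> decode n \<in> phases"
  using bij_code unfolding decode_def bij_betw_def by (metis atLeast0LessThan inv_into_into lessThan_iff)

lemma code_less: "q \<in> phases \<Longrightarrow> code q < card phases"
  using bij_code unfolding bij_betw_def by (metis atLeast0LessThan imageI lessThan_iff)

lemma in_phases [simp]:
  "Scan \<in> phases" "Final \<in> phases" "Copy c \<in> phases" "Trim \<in> phases" "Seek \<in> phases" "Halt \<in> phases"
  "Add n \<in> phases \<longleftrightarrow> n \<le> 2"
  "Run p q \<in> phases \<longleftrightarrow> p < tm_states M \<and> q < tm_states N"
  by (cases c) (auto simp: phases_def)

text \<open>Scanned symbols are arbitrary here, possibly above 2; the \<open>min 2\<close> in phase
  \<open>Add\<close> keeps the carry in range even then.\<close>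

lemma trans_wf:
  assumes "q \<in> phases" "length ss = tm_tapes M" "length us = tm_tapes N"
    and "trans q i ss us x = (q', a, as, bs, b)"
  shows "q' \<in> phases" "length as = tm_tapes M" "length bs = tm_tapes N"
proof -
  have pos: "0 < tm_tapes M" "0 < tm_tapes N" "tm_start M < tm_states M" "tm_start N < tm_states N"
    "tm_halt M < tm_states M" "tm_halt N < tm_states N"
    using wf by (auto simp: wf_tm_def)
  have "q' \<in> phases \<and> length as = tm_tapes M \<and> length bs = tm_tapes N"
  proof (cases q)
    case (Run p r)
    then show ?thesis
      using assms guarded_delta_wf(1,2)[OF wf(1), of p ss] guarded_delta_wf(1,2)[OF wf(2), of r us]
      by (auto split: if_splits prod.splits)
  qed (use assms pos in \<open>auto simp: Let_def split: if_splits\<close>)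
  then show "q' \<in> phases" "length as = tm_tapes M" "length bs = tm_tapes N"
    by simp_all
qed

text \<open>Outside the simulation only symbols just read and symbols up to 2 are written, and every
  alphabet has at least 3 symbols.\<close>

lemma trans_symbols:
  assumes "q \<in> phases" "length ss = tm_tapes M" "length us = tm_tapes N"
    and "trans q i ss us x = (q', a, as, bs, b)"
    and "set ss \<subseteq> {..<n}" "set us \<subseteq> {..<n}" "i < n" "x < n" "tm_symbols M \<le> n" "tm_symbols N \<le> n"
  shows "fst a < n" "writes_below n as" "writes_below n bs" "fst b < n"
proof -
  have n: "3 \<le> n"
    using wf assms(9) by (auto simp: wf_tm_def)
  have "ss \<noteq> []" "us \<noteq> []"
    using wf assms(2,3) by (auto simp: wf_tm_def)
  then have last: "last ss < n" "last us < n"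
    using assms(5,6) last_in_set by blast+
  have sum: "2 - k mod 2 < n" for k
    using n by linarith
  note written = writes_below_acts[OF assms(5)] writes_below_acts[OF assms(6)]
  have "fst a < n \<and> writes_below n as \<and> writes_below n bs \<and> fst b < n"
  proof (cases q)
    case (Run p r)
    then show ?thesis
      using assms guarded_delta_wf(3)[OF wf(1), of p ss] guarded_delta_wf(3)[OF wf(2), of r us] written
      by (auto split: if_splits prod.splits)
  next
    case (Add c)
    show ?thesis
    proof (cases "last ss + last us + c = 0")
      case True
      then show ?thesis
        using assms(4,7) n written Add by auto
    next
      case False
      then have "a = (i, Stay)" "as = on_last (last ss, MoveLeft) ss" "bs = on_last (last us, MoveLeft) us"
        "fst b = 2 - (last ss + last us + c) mod 2"
        using assms(4) Add by (auto simp: Let_def)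
      then show ?thesis
        using assms(7) last sum written by simp
    qed
  qed (use assms(4-8) n last written in \<open>auto split: if_splits\<close>)
  then show "fst a < n" "writes_below n as" "writes_below n bs" "fst b < n"
    by simp_all
qed

section \<open>The join machine as a machine of type \<open>tm\<close>\<close>

definition join_tm :: tm where
  "join_tm =
     \<lparr>tm_tapes = Suc (tm_tapes M + tm_tapes N + 1),
      tm_states = card phases,
      tm_symbols = max (tm_symbols M) (tm_symbols N),
      tm_start = code Scan,
      tm_halt = code Halt,
      tm_delta = (\<lambda>n ss.
        case trans (decode n) (hd ss) (take (tm_tapes M) (tl ss))
          (take (tm_tapes N) (drop (tm_tapes M) (tl ss))) (last ss) of
          (q, a, as, bs, b) \<Rightarrow> (code q, a # as @ bs @ [b]))\<rparr>"

lemma wf_join_tm: "wf_tm join_tm"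
proof -
  have "q' < card phases \<and> length acts = Suc (tm_tapes M + tm_tapes N + 1) \<and>
      fst ` set acts \<subseteq> {..<max (tm_symbols M) (tm_symbols N)}"
    if n: "n < card phases" and len: "length ss = Suc (tm_tapes M + tm_tapes N + 1)"
      and ss: "set ss \<subseteq> {..<max (tm_symbols M) (tm_symbols N)}"
      and delta: "tm_delta join_tm n ss = (q', acts)" for n ss q' acts
  proof -
    let ?k = "max (tm_symbols M) (tm_symbols N)"
    let ?us = "take (tm_tapes M) (tl ss)" and ?vs = "take (tm_tapes N) (drop (tm_tapes M) (tl ss))"
    obtain q a as bs b where t: "trans (decode n) (hd ss) ?us ?vs (last ss) = (q, a, as, bs, b)"
      by (metis prod_cases5)
    have acts: "q' = code q" "acts = a # as @ bs @ [b]"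
      using delta by (simp_all add: join_tm_def t)
    have len': "length ?us = tm_tapes M" "length ?vs = tm_tapes N"
      using len by simp_all
    have ne: "ss \<noteq> []"
      using len by auto
    have sym: "hd ss < ?k" "last ss < ?k" "set ?us \<subseteq> {..<?k}" "set ?vs \<subseteq> {..<?k}"
      using hd_in_set[OF ne] last_in_set[OF ne] ss list.set_sel(2)[OF ne]
      by (fastforce dest!: in_set_takeD in_set_dropD)+
    note wf' = trans_wf[OF decode_in_phases[OF n] len' t]
    note symbols = trans_symbols[OF decode_in_phases[OF n] len' t sym(3,4,1,2)]
    show ?thesis
      using wf' symbols code_less by (auto simp: acts writes_below_def image_subset_iff)
  qed
  moreover have "3 \<le> max (tm_symbols M) (tm_symbols N)"
    using wf by (auto simp: wf_tm_def)
  ultimately show ?thesis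
    unfolding wf_tm_def by (auto simp: join_tm_def code_less)
qed

fun join_config :: "join_config \<Rightarrow> config" where
  "join_config (q, i, ts, us, x) = (code q, i # ts @ us @ [x])"

fun valid_join_config :: "join_config \<Rightarrow> bool" where
  "valid_join_config (q, i, ts, us, x) \<longleftrightarrow>
     q \<in> phases \<and> length ts = tm_tapes M \<and> length us = tm_tapes N"

lemma code_eq_Halt: "q \<in> phases \<Longrightarrow> code q = code Halt \<longleftrightarrow> q = Halt"
  using decode_code by (metis in_phases(6))

text \<open>In the halting state \<open>step\<close> stops by itself, and \<open>advance\<close>
  idles there too. No other phase has the code of \<open>Halt\<close>, so elsewhere the transition
  is really taken.\<close>

lemma step_join_tm:
  assumes "valid_join_config c"
  shows "step join_tm (join_config c) = join_config (advance c)" "valid_join_config (advance c)"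
proof -
  obtain q i ts us x where c: "c = (q, i, ts, us, x)"
    by (metis prod_cases5)
  obtain q' a as bs b where t: "trans q (i 0) (scanned ts) (scanned us) (x 0) = (q', a, as, bs, b)"
    by (metis prod_cases5)
  have q: "q \<in> phases" "length ts = tm_tapes M" "length us = tm_tapes N"
    using assms by (simp_all add: c)
  note wf' = trans_wf[OF q(1) _ _ t]
  show "valid_join_config (advance c)"
    using wf' q by (simp add: c t)
  show "step join_tm (join_config c) = join_config (advance c)"
  proof (cases "q = Halt")
    case True
    then show ?thesis
      by (simp add: c step_def join_tm_def)
  next
    case False
    then show ?thesis
      using wf' q by (simp add: c t step_def join_tm_def code_eq_Halt decode_code)
  qed
qed

lemma funpow_step_join_tm:
  "valid_join_config c \<Longrightarrow>
   (step join_tm ^^ n) (join_config c) = join_config ((advance ^^ n) c) \<and>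
   valid_join_config ((advance ^^ n) c)"
  by (induction n) (simp_all add: step_join_tm)

lemma init_join_tm:
  "init_config join_tm y = join_config (Scan, string_tape y, replicate (tm_tapes M) blank_tape,
     replicate (tm_tapes N) blank_tape, blank_tape)"
  by (simp add: init_config_def join_tm_def replicate_add replicate_append_same)

lemma join_tm_halts:
  assumes "reaches n (Scan, string_tape y, replicate (tm_tapes M) blank_tape,
     replicate (tm_tapes N) blank_tape, blank_tape) (Halt, i, ts, us, string_tape z)"
  shows "\<exists>m\<le>n. \<exists>ts. (step join_tm ^^ m) (init_config join_tm y) = (tm_halt join_tm, ts) \<and>
    last ts = string_tape z"
proof -
  let ?c = "(Scan, string_tape y, replicate (tm_tapes M) blank_tape,
     replicate (tm_tapes N) blank_tape, blank_tape)"
  obtain m where m: "m \<le> n" "(advance ^^ m) ?c = (Halt, i, ts, us, string_tape z)"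
    using assms by (auto simp: reaches_def)
  have "(step join_tm ^^ m) (init_config join_tm y) = (code Halt, i # ts @ us @ [string_tape z])"
    using funpow_step_join_tm[of ?c m] by (simp add: init_join_tm m(2))
  then show ?thesis
    using m(1) by (auto simp: join_tm_def)
qed

text \<open>The one input without a last symbol: \<open>Final\<close> meets a blank and stops,
  leaving the empty output, which is the rank 0.\<close>

lemma reaches_Nil:
  "\<exists>i. reaches 2 (Scan, string_tape [], ts, us, blank_tape) (Halt, i, ts, us, string_tape [])"
proof -
  have "reaches 1 (Scan, string_tape [], ts, us, blank_tape) (Final, left_of [] [], ts, us, blank_tape)"
    using reaches_Scan[of "[]" "[]"] by (simp add: string_tape_eq)
  moreover have "reaches 1 (Final, left_of [] [], ts, us, blank_tape)
      (Halt, left_of [] [], ts, us, string_tape [])"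
    using reaches_step[of 0 "(Final, left_of [] [], ts, us, blank_tape)"] map2_act_keep
    by (simp add: reaches_refl string_tape_eq flip: blank_tape_eq(2))
  ultimately show ?thesis
    by (intro exI) (rule reaches_trans, auto)
qed

end

theorem theorem28:
  fixes A B :: "bool list set"
  assumes "strong_P_rankable A" and "strong_P_rankable B"
  shows "strong_P_rankable (join A B)"
proof -
  obtain f M p where f: "\<And>x. nat_of_string (f x) = rank A x" and M: "wf_tm M" "computes_in_time M f (poly p)"
    using assms(1) by (auto simp: strong_P_rankable_def polytime_computable_def)
  obtain g N q where g: "\<And>x. nat_of_string (g x) = rank B x" and N: "wf_tm N" "computes_in_time N g (poly q)"
    using assms(2) by (auto simp: strong_P_rankable_def polytime_computable_def)
  interpret join_machine M N
    using M(1) N(1) by unfold_locales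
  \<comment> \<open>The numbering is onto, so every rank is the number of a string.\<close>
  define h where "h y = inv nat_of_string (rank (join A B) y)" for y
  have h: "nat_of_string (h y) = rank (join A B) y" for y
    unfolding h_def using bij_nat_of_string by (simp add: bij_is_surj surj_f_inv_f)
  have "\<exists>n\<le>poly (p + q + [:12, 6:]) (length y). \<exists>ts.
      (step join_tm ^^ n) (init_config join_tm y) = (tm_halt join_tm, ts) \<and> last ts = string_tape (h y)"
    for y
  proof (cases y rule: rev_exhaust)
    case Nil
    have "h [] = []"
      using h[of "[]"] strict_mono_nat_of_string
      by (metis nat_of_string_Nil rank_join_Nil strict_mono_eq)
    then obtain n ts where "n \<le> 2" "(step join_tm ^^ n) (init_config join_tm y) = (tm_halt join_tm, ts)"
      "last ts = string_tape (h y)"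
      using reaches_Nil join_tm_halts Nil by metis
    then show ?thesis
      by (intro exI[of _ n]) auto
  next
    case (snoc x b)
    have "nat_of_string (h y) = nat_of_string (f x) +
      (if b then nat_of_string (g x) else if x = [] then 0 else nat_of_string (g (pred_string x)))"
      by (simp add: h snoc rank_join_snoc f g)
    then show ?thesis
      using reaches_join[OF M(2) length_le_of_rank[OF f] N(2) length_le_of_rank[OF g]] join_tm_halts snoc
      by metis
  qed
  then have "computes_in_time join_tm h (poly (p + q + [:12, 6:]))"
    unfolding computes_in_time_def by blast
  then show ?thesis
    unfolding strong_P_rankable_def polytime_computable_def using wf_join_tm h by blast
qed

end
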